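(* Let $N \geq 2$ and $n \geq 1$ be integers with $n \leq N$, let $X = \{1,\ldots,N\}$, and let $\mu$ be the uniform probability measure on $X$. Let $Z = (Z_1,\ldots,Z_n)$ be a random $n$-tuple of points of $X$ whose law is the uniform probability measure on the set of $n$-tuples $(i_1,\ldots,i_n) \in X^n$ whose coordinates are pairwise different. Then $$\sup_{\substack{f \in L^2(X,\mu) \\ \Vert f \Vert_2 = 1}} \operatorname{Var}\left(\frac{1}{n}\sum_{i=1}^n f(Z_i) - \int_X f \, d\mu\right) = \frac{1}{n}\left(1 - \frac{n-1}{N-1}\right).$$
   Context: $L^2(X,\mu)$ is the space of (real- or complex-valued) functions on $X$ with norm $\Vert f\Vert_2 = \left(\int_X |f|^2 \, d\mu\right)^{1/2} = \left(\frac{1}{N}\sum_{k=1}^N |f(k)|^2\right)^{1/2}$. $\operatorname{Var}(Y) = \mathbb{E}\left[|Y - \mathbb{E}[Y]|^2\right]$ denotes the variance, taken with respect to the probability space on which $Z$ is defined. *)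

theory Defs
  imports "HOL-Probability.Probability"
begin

definition L2_space ::
    "'a measure \<Rightarrow> ('a \<Rightarrow> 'b::{banach, second_countable_topology}) set" where
  "L2_space M = {f \<in> borel_measurable M. integrable M (\<lambda>x. (norm (f x))\<^sup>2)}"

definition L2_norm ::
    "'a measure \<Rightarrow> ('a \<Rightarrow> 'b::{banach, second_countable_topology}) \<Rightarrow> real" where
  "L2_norm M f = sqrt (\<integral>x. (norm (f x))\<^sup>2 \<partial>M)"

(* prob_space.variance is restricted to real-valued random variables. *)
definition Var ::
    "'w measure \<Rightarrow> ('w \<Rightarrow> 'b::{banach, second_countable_topology}) \<Rightarrow> real" where
  "Var M Y = (\<integral>w. (norm (Y w - (\<integral>v. Y v \<partial>M)))\<^sup>2 \<partial>M)"

definition points :: "nat \<Rightarrow> nat set" where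
  "points N = {1..N}"

definition unif :: "nat \<Rightarrow> nat measure" where
  "unif N = uniform_count_measure (points N)"

(* An n-tuple is an extensional function on {1..n}. *)
definition tuples :: "nat \<Rightarrow> nat \<Rightarrow> (nat \<Rightarrow> nat) set" where
  "tuples N n = ({1..n} \<rightarrow>\<^sub>E points N)"

definition distinct_tuples :: "nat \<Rightarrow> nat \<Rightarrow> (nat \<Rightarrow> nat) set" where
  "distinct_tuples N n =
     {t \<in> tuples N n. \<forall>i\<in>{1..n}. \<forall>j\<in>{1..n}. i \<noteq> j \<longrightarrow> t i \<noteq> t j}"

definition sampling_error ::
    "nat \<Rightarrow> nat \<Rightarrow> ('w \<Rightarrow> nat \<Rightarrow> nat) \<Rightarrow> (nat \<Rightarrow> 'b::{banach, second_countable_topology})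
       \<Rightarrow> 'w \<Rightarrow> 'b" where
  "sampling_error N n Z f w =
     (1 / real n) *\<^sub>R (\<Sum>i=1..n. f (Z w i)) - (\<integral>x. f x \<partial>unif N)"

end

theory Submission
  imports Defs
begin

text \<open>
  Subtracting the mean of \<open>f\<close> changes neither the sampling error nor its variance, so let
  \<open>g = f - mean f\<close>, which sums to zero over the points. Expanding the square, the variance is the
  average over all pairs \<open>(i, j)\<close> of the expectation of \<open>g(Z\<^sub>i) \<bullet> g(Z\<^sub>j)\<close>.

  The set of distinct tuples is invariant under relabelling the points by a permutation, and
  permutations act transitively on points and on ordered pairs of distinct points. Hence each
  \<open>Z\<^sub>i\<close> is uniform on the points, and \<open>(Z\<^sub>i, Z\<^sub>j)\<close> for \<open>i \<noteq> j\<close> is uniform on the pairs of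
  distinct points (\<open>sum_distinct_tuples_marginal\<close>, \<open>sum_distinct_tuples_pair_marginal\<close>).
  With \<open>V\<close> the mean of the squared norm of \<open>g\<close>, the diagonal terms are therefore \<open>V\<close>. Since \<open>g\<close>
  sums to zero, its correlations over all ordered pairs of points cancel, and those over distinct
  pairs sum to \<open>- N V\<close>: the off-diagonal terms are \<open>- V / (N - 1)\<close>. Adding up gives the exact
  formula (\<open>Var_sampling_error\<close>), the variance being \<open>V\<close> times the claimed constant.

  Finally \<open>V\<close> is the squared norm of \<open>f\<close> minus the squared norm of its mean, so it is at most \<open>1\<close>
  on the unit sphere, with equality exactly for functions of mean zero; such functions of norm
  one exist because there are at least two points. The argument uses only the inner product of the
  target space, so the real and the complex case are instances of one statement
  (\<open>SUP_Var_sampling_error\<close>).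
\<close>

section \<open>Marginals of the uniform law on distinct tuples\<close>

text \<open>
  A map all of whose fibres have the same size pushes the uniform distribution forward to the
  uniform distribution.
\<close>
lemma sum_equal_fibres:
  fixes h :: "'s \<Rightarrow> 'b::real_vector"
  assumes "finite D" "finite S" "k ` D \<subseteq> S"
    and fibre_le: "\<And>s s'. s \<in> S \<Longrightarrow> s' \<in> S \<Longrightarrow>
          card {t \<in> D. k t = s} \<le> card {t \<in> D. k t = s'}"
  shows "(\<Sum>t\<in>D. h (k t)) = (real (card D) / real (card S)) *\<^sub>R (\<Sum>s\<in>S. h s)"
proof (cases "S = {}")
  case True
  with assms show ?thesis by auto
next
  case False
  then obtain s0 where s0: "s0 \<in> S" by auto
  define c where "c = card {t \<in> D. k t = s0}"
  have c: "card {t \<in> D. k t = s} = c" if "s \<in> S" for s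
    unfolding c_def using fibre_le s0 that by (meson le_antisym)
  have "card D = (\<Sum>s\<in>S. card {t \<in> D. k t = s})"
    using sum.group[OF assms(1-3), of "\<lambda>_. 1::nat"] by simp
  then have "card D = card S * c" by (simp add: c)
  moreover have "card S \<noteq> 0" using False assms(2) by simp
  ultimately have cc: "real (card D) / real (card S) = real c" by simp
  have "(\<Sum>t\<in>D. h (k t)) = (\<Sum>s\<in>S. \<Sum>t\<in>{t \<in> D. k t = s}. h (k t))"
    using sum.group[OF assms(1-3), of "\<lambda>t. h (k t)"] by simp
  also have "\<dots> = (\<Sum>s\<in>S. \<Sum>t\<in>{t \<in> D. k t = s}. h s)"
    by (intro sum.cong) auto
  also have "\<dots> = (\<Sum>s\<in>S. real c *\<^sub>R h s)"
    by (intro sum.cong) (simp_all add: sum_constant_scaleR c del: sum_constant)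
  finally show ?thesis by (simp add: cc scaleR_sum_right)
qed

lemma finite_points [simp]: "finite (points N)"
  and card_points [simp]: "card (points N) = N"
  by (simp_all add: points_def)

lemma finite_tuples [simp]: "finite (tuples N n)"
  by (simp add: tuples_def finite_PiE)

lemma distinct_tuples_subset: "distinct_tuples N n \<subseteq> tuples N n"
  by (auto simp: distinct_tuples_def)

lemma finite_distinct_tuples [simp]: "finite (distinct_tuples N n)"
  using distinct_tuples_subset finite_tuples by (rule finite_subset)

lemma card_distinct_tuples_pos:
  assumes "n \<le> N"
  shows "card (distinct_tuples N n) > 0"
proof -
  have "restrict id {1..n} \<in> distinct_tuples N n"
    using assms by (auto simp: distinct_tuples_def tuples_def points_def)
  then show ?thesis by (auto simp: card_gt_0_iff)
qed

lemma distinct_tuples_mem: "t \<in> distinct_tuples N n \<Longrightarrow> i \<in> {1..n} \<Longrightarrow> t i \<in> points N"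
  by (auto simp: distinct_tuples_def tuples_def)

lemma relabel_distinct_tuples:
  assumes "\<sigma> permutes points N" "t \<in> distinct_tuples N n"
  shows "restrict (\<sigma> \<circ> t) {1..n} \<in> distinct_tuples N n"
  using assms permutes_inj[OF assms(1)]
  by (auto simp: distinct_tuples_def tuples_def permutes_in_image PiE_iff inj_eq)

text \<open>
  Relabelling by \<open>\<sigma>\<close> embeds one fibre into another. Applied in both directions, this one-sided
  bound yields equality of fibre sizes.
\<close>
lemma card_fibre_relabel_le:
  assumes "\<sigma> permutes points N" "i \<in> {1..n}" "j \<in> {1..n}"
  shows "card {t \<in> distinct_tuples N n. t i = a \<and> t j = b}
       \<le> card {t \<in> distinct_tuples N n. t i = \<sigma> a \<and> t j = \<sigma> b}"
proof (rule card_inj_on_le)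
  let ?r = "\<lambda>t. restrict (\<sigma> \<circ> t) {1..n}"
  show "inj_on ?r {t \<in> distinct_tuples N n. t i = a \<and> t j = b}"
  proof (rule inj_onI)
    fix s t
    assume s: "s \<in> {t \<in> distinct_tuples N n. t i = a \<and> t j = b}"
      and t: "t \<in> {t \<in> distinct_tuples N n. t i = a \<and> t j = b}"
      and eq: "?r s = ?r t"
    have "s k = t k" if "k \<in> {1..n}" for k
      using fun_cong[OF eq, of k] that permutes_inj[OF assms(1)] by (simp add: inj_eq)
    moreover have "s \<in> extensional {1..n}" "t \<in> extensional {1..n}"
      using s t by (auto simp: distinct_tuples_def tuples_def PiE_def)
    ultimately show "s = t" by (metis extensionalityI)
  qed
  show "?r ` {t \<in> distinct_tuples N n. t i = a \<and> t j = b}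
      \<subseteq> {t \<in> distinct_tuples N n. t i = \<sigma> a \<and> t j = \<sigma> b}"
    using relabel_distinct_tuples[OF assms(1)] assms(2,3) by auto
qed auto

lemma sum_distinct_tuples_marginal:
  fixes h :: "nat \<Rightarrow> 'b::real_vector"
  assumes "i \<in> {1..n}"
  shows "(\<Sum>t\<in>distinct_tuples N n. h (t i)) =
    (real (card (distinct_tuples N n)) / real N) *\<^sub>R (\<Sum>a\<in>points N. h a)"
proof -
  have "card {t \<in> distinct_tuples N n. t i = a} \<le> card {t \<in> distinct_tuples N n. t i = a'}"
    if "a \<in> points N" "a' \<in> points N" for a a'
    using card_fibre_relabel_le[OF permutes_swap_id[OF that] assms assms, of a a] by simp
  then show ?thesis
    using sum_equal_fibres[of "distinct_tuples N n" "points N" "\<lambda>t. t i" h]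
      distinct_tuples_mem[OF _ assms] by (simp add: image_subset_iff)
qed

definition distinct_pairs :: "nat \<Rightarrow> (nat \<times> nat) set" where
  "distinct_pairs N = points N \<times> points N - (\<lambda>a. (a, a)) ` points N"

lemma finite_distinct_pairs [simp]: "finite (distinct_pairs N)"
  by (simp add: distinct_pairs_def)

lemma card_distinct_pairs: "real (card (distinct_pairs N)) = real N * (real N - 1)"
proof -
  have "card (distinct_pairs N) = N * N - N"
    unfolding distinct_pairs_def
    by (subst card_Diff_subset) (auto simp: card_image inj_on_def card_cartesian_product)
  then show ?thesis
    by (simp add: of_nat_diff algebra_simps)
qed

text \<open>
  Permutations act transitively on ordered pairs of distinct points: after one transposition
  has put the first component right, a second one corrects the other component without
  moving the first, precisely because the components are distinct.
\<close>
lemma distinct_pairs_transitive: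
  assumes "(a, b) \<in> distinct_pairs N" "(a', b') \<in> distinct_pairs N"
  obtains \<sigma> where "\<sigma> permutes points N" "\<sigma> a = a'" "\<sigma> b = b'"
proof
  let ?\<tau> = "Transposition.transpose a a'"
  have pts: "a \<in> points N" "b \<in> points N" "a' \<in> points N" "b' \<in> points N"
    and ne: "a \<noteq> b" "a' \<noteq> b'"
    using assms by (auto simp: distinct_pairs_def)
  have \<tau>: "?\<tau> permutes points N"
    using pts by (intro permutes_swap_id)
  then have "?\<tau> b \<in> points N"
    using pts by (simp add: permutes_in_image)
  then show "Transposition.transpose (?\<tau> b) b' \<circ> ?\<tau> permutes points N"
    using \<tau> pts by (intro permutes_compose permutes_swap_id)
  have "?\<tau> b \<noteq> a'"
    using ne by (metis transpose_apply_second transpose_involutory)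
  then show "(Transposition.transpose (?\<tau> b) b' \<circ> ?\<tau>) a = a'"
    using ne by (simp add: transpose_apply_other)
  show "(Transposition.transpose (?\<tau> b) b' \<circ> ?\<tau>) b = b'" by simp
qed

lemma sum_distinct_tuples_pair_marginal:
  fixes h :: "nat \<Rightarrow> nat \<Rightarrow> 'b::real_vector"
  assumes "i \<in> {1..n}" "j \<in> {1..n}" "i \<noteq> j"
  shows "(\<Sum>t\<in>distinct_tuples N n. h (t i) (t j)) =
    (real (card (distinct_tuples N n)) / (real N * (real N - 1))) *\<^sub>R
      (\<Sum>(a, b)\<in>distinct_pairs N. h a b)"
proof -
  have "card {t \<in> distinct_tuples N n. (t i, t j) = p}
      \<le> card {t \<in> distinct_tuples N n. (t i, t j) = p'}"
    if p: "p \<in> distinct_pairs N" "p' \<in> distinct_pairs N" for p p'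
  proof -
    obtain a b a' b' where ab: "p = (a, b)" "p' = (a', b')" by (metis surj_pair)
    obtain \<sigma> where "\<sigma> permutes points N" "\<sigma> a = a'" "\<sigma> b = b'"
      using distinct_pairs_transitive p unfolding ab by blast
    then show ?thesis
      using card_fibre_relabel_le[of \<sigma> N i n j a b] assms unfolding ab by simp
  qed
  moreover have "(\<lambda>t. (t i, t j)) ` distinct_tuples N n \<subseteq> distinct_pairs N"
    using assms by (auto simp: distinct_pairs_def distinct_tuples_mem)
       (auto simp: distinct_tuples_def)
  ultimately show ?thesis
    using sum_equal_fibres[of "distinct_tuples N n" "distinct_pairs N"
        "\<lambda>t. (t i, t j)" "case_prod h"]
    by (simp add: card_distinct_pairs)
qed

section \<open>The second moment of a centred sample sum\<close>

lemma sum_inner_distinct_pairs: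
  fixes g :: "nat \<Rightarrow> 'b::real_inner"
  assumes "(\<Sum>a\<in>points N. g a) = 0"
  shows "(\<Sum>(a, b)\<in>distinct_pairs N. g a \<bullet> g b) = - (\<Sum>a\<in>points N. (norm (g a))\<^sup>2)"
proof -
  have "(\<Sum>(a, b)\<in>distinct_pairs N. g a \<bullet> g b) =
      (\<Sum>(a, b)\<in>points N \<times> points N. g a \<bullet> g b) -
      (\<Sum>(a, b)\<in>(\<lambda>a. (a, a)) ` points N. g a \<bullet> g b)"
    unfolding distinct_pairs_def by (intro sum_diff) auto
  moreover have "(\<Sum>(a, b)\<in>points N \<times> points N. g a \<bullet> g b) =
      (\<Sum>a\<in>points N. g a) \<bullet> (\<Sum>b\<in>points N. g b)"
    by (simp add: sum.cartesian_product[symmetric] inner_sum_left inner_sum_right inner_commute)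
  moreover have "(\<Sum>(a, b)\<in>(\<lambda>a. (a, a)) ` points N. g a \<bullet> g b) =
      (\<Sum>a\<in>points N. (norm (g a))\<^sup>2)"
    by (subst sum.reindex) (auto simp: inj_on_def power2_norm_eq_inner)
  ultimately show ?thesis using assms by simp
qed

lemma sum_distinct_tuples_norm_sum_square:
  fixes g :: "nat \<Rightarrow> 'b::real_inner"
  assumes "N \<ge> 2" and "n \<ge> 1" and centred: "(\<Sum>a\<in>points N. g a) = 0"
  shows "(\<Sum>t\<in>distinct_tuples N n. (norm (\<Sum>i=1..n. g (t i)))\<^sup>2) =
    real (card (distinct_tuples N n)) * real n * (1 - (real n - 1) / (real N - 1)) *
      ((\<Sum>a\<in>points N. (norm (g a))\<^sup>2) / real N)"
proof -
  define D where "D = distinct_tuples N n"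
  define V where "V = (\<Sum>a\<in>points N. (norm (g a))\<^sup>2) / real N"
  define c where "c = real (card D) * V"
  define e where "e = - c / (real N - 1)"
  have pair: "(\<Sum>t\<in>D. g (t i) \<bullet> g (t j)) = (if i = j then c else e)"
    if "i \<in> {1..n}" "j \<in> {1..n}" for i j
  proof (cases "i = j")
    case True
    then show ?thesis
      using sum_distinct_tuples_marginal[OF that(1), where h = "\<lambda>a. (norm (g a))\<^sup>2" and N = N]
      by (simp add: D_def c_def V_def power2_norm_eq_inner)
  next
    case False
    then show ?thesis
      using sum_distinct_tuples_pair_marginal[OF that False, where h = "\<lambda>a b. g a \<bullet> g b" and N = N]
      by (simp add: D_def e_def c_def V_def sum_inner_distinct_pairs[OF centred])
  qed
  have "(\<Sum>t\<in>D. (norm (\<Sum>i=1..n. g (t i)))\<^sup>2) =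
      (\<Sum>t\<in>D. \<Sum>i=1..n. \<Sum>j=1..n. g (t i) \<bullet> g (t j))"
    by (simp only: power2_norm_eq_inner inner_sum_left inner_sum_right inner_commute)
  also have "\<dots> = (\<Sum>i=1..n. \<Sum>t\<in>D. \<Sum>j=1..n. g (t i) \<bullet> g (t j))"
    by (rule sum.swap)
  also have "\<dots> = (\<Sum>i=1..n. \<Sum>j=1..n. \<Sum>t\<in>D. g (t i) \<bullet> g (t j))"
    by (intro sum.cong refl sum.swap)
  also have "\<dots> = (\<Sum>i=1..n. \<Sum>j=1..n. if i = j then c else e)"
    by (intro sum.cong refl pair)
  also have "\<dots> = (\<Sum>i=1..n. c + (real n - 1) * e)"
  proof (intro sum.cong refl)
    fix i assume i: "i \<in> {1..n}"
    have "(\<Sum>j=1..n. if i = j then c else e) = c + (\<Sum>j\<in>{1..n} - {i}. if i = j then c else e)"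
      using i by (subst sum.remove[of _ i]) auto
    also have "(\<Sum>j\<in>{1..n} - {i}. if i = j then c else e) = (\<Sum>j\<in>{1..n} - {i}. e)"
      by (intro sum.cong) auto
    finally show "(\<Sum>j=1..n. if i = j then c else e) = c + (real n - 1) * e"
      using i \<open>n \<ge> 1\<close> by (simp add: of_nat_diff)
  qed
  also have "\<dots> = real (card D) * real n * (1 - (real n - 1) / (real N - 1)) * V"
    using \<open>N \<ge> 2\<close> by (simp add: e_def c_def field_simps)
  finally show ?thesis by (simp add: D_def V_def)
qed

section \<open>The variance of the sampling error\<close>

lemma integral_unif:
  fixes f :: "nat \<Rightarrow> 'b::{banach, second_countable_topology}"
  shows "(\<integral>x. f x \<partial>unif N) = (1 / real N) *\<^sub>R (\<Sum>a\<in>points N. f a)"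
  by (simp add: unif_def uniform_count_measure_def lebesgue_integral_point_measure_finite
      scaleR_sum_right)

text \<open>
  Expectations depend only on the law of \<open>Z\<close>, hence are averages over the distinct tuples.
\<close>
lemma expectation_distinct_tuples:
  fixes g :: "(nat \<Rightarrow> nat) \<Rightarrow> 'b::{banach, second_countable_topology}"
  assumes "n \<le> N" and Z: "Z \<in> M \<rightarrow>\<^sub>M count_space (tuples N n)"
    and law: "distr M (count_space (tuples N n)) Z =
           uniform_measure (count_space (tuples N n)) (distinct_tuples N n)"
  shows "(\<integral>w. g (Z w) \<partial>M) =
    (1 / real (card (distinct_tuples N n))) *\<^sub>R (\<Sum>t\<in>distinct_tuples N n. g t)"
proof -
  define D where "D = distinct_tuples N n"
  have D: "D \<subseteq> tuples N n" "card D > 0" "finite D"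
    using distinct_tuples_subset card_distinct_tuples_pos[OF \<open>n \<le> N\<close>] by (auto simp: D_def)
  have dens: "indicator D t / emeasure (count_space (tuples N n)) D
      = ennreal (indicator D t / real (card D))" for t
    using D by (simp add: emeasure_count_space_finite divide_ennreal ennreal_of_nat_eq_real_of_nat
        flip: ennreal_indicator)
  have "(\<integral>w. g (Z w) \<partial>M) = (\<integral>t. g t \<partial>distr M (count_space (tuples N n)) Z)"
    using Z by (intro integral_distr[symmetric]) auto
  also have "\<dots> = (\<integral>t. (indicator D t / real (card D)) *\<^sub>R g t \<partial>count_space (tuples N n))"
    unfolding law uniform_measure_def D_def[symmetric] dens
    by (subst integral_density) auto
  also have "\<dots> = (\<Sum>t\<in>tuples N n. (indicator D t / real (card D)) *\<^sub>R g t)"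
    by (simp add: lebesgue_integral_count_space_finite)
  also have "\<dots> = (\<Sum>t\<in>D. (1 / real (card D)) *\<^sub>R g t)"
    using D by (intro sum.mono_neutral_cong_right) auto
  finally show ?thesis by (simp add: D_def scaleR_sum_right)
qed

lemma Var_sampling_error:
  fixes f :: "nat \<Rightarrow> 'b::{real_inner, banach, second_countable_topology}"
  assumes "N \<ge> 2" and "n \<ge> 1" and "n \<le> N"
    and "Z \<in> M \<rightarrow>\<^sub>M count_space (tuples N n)"
    and "distr M (count_space (tuples N n)) Z =
           uniform_measure (count_space (tuples N n)) (distinct_tuples N n)"
  shows "Var M (sampling_error N n Z f) =
    1 / real n * (1 - (real n - 1) / (real N - 1)) *
      ((L2_norm (unif N) f)\<^sup>2 - (norm (\<integral>x. f x \<partial>unif N))\<^sup>2)"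
proof -
  define D where "D = distinct_tuples N n"
  define m where "m = (\<integral>x. f x \<partial>unif N)"
  define g where "g a = f a - m" for a
  have D: "card D > 0"
    using card_distinct_tuples_pos[OF \<open>n \<le> N\<close>] by (simp add: D_def)
  have sum_f: "(\<Sum>a\<in>points N. f a) = real N *\<^sub>R m"
    using \<open>N \<ge> 2\<close> by (simp add: m_def integral_unif)
  then have centred: "(\<Sum>a\<in>points N. g a) = 0"
    by (simp add: g_def sum_subtractf sum_constant_scaleR del: sum_constant)
  have err: "sampling_error N n Z f w = (1 / real n) *\<^sub>R (\<Sum>i=1..n. g (Z w i))" for w
    using \<open>n \<ge> 1\<close>
    by (simp add: sampling_error_def g_def m_def[symmetric] sum_subtractf sum_constant_scaleR
        scaleR_diff_right del: sum_constant)
  note E = expectation_distinct_tuples[OF assms(3-5)]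
  have "(\<integral>w. sampling_error N n Z f w \<partial>M) =
      (1 / real (card D)) *\<^sub>R (\<Sum>t\<in>D. (1 / real n) *\<^sub>R (\<Sum>i=1..n. g (t i)))"
    unfolding err D_def by (rule E)
  also have "(\<Sum>t\<in>D. (1 / real n) *\<^sub>R (\<Sum>i=1..n. g (t i))) =
      (1 / real n) *\<^sub>R (\<Sum>i=1..n. \<Sum>t\<in>D. g (t i))"
    unfolding scaleR_sum_right[symmetric] by (subst sum.swap) (rule refl)
  also have "\<dots> = 0"
    by (simp add: D_def sum_distinct_tuples_marginal centred)
  finally have mean: "(\<integral>w. sampling_error N n Z f w \<partial>M) = 0" by simp
  have "Var M (sampling_error N n Z f) =
      (\<integral>w. (norm ((1 / real n) *\<^sub>R (\<Sum>i=1..n. g (Z w i))))\<^sup>2 \<partial>M)"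
    unfolding Var_def mean err by simp
  also have "\<dots> = (1 / real (card D)) *\<^sub>R
      (\<Sum>t\<in>D. (norm ((1 / real n) *\<^sub>R (\<Sum>i=1..n. g (t i))))\<^sup>2)"
    unfolding D_def by (rule E)
  also have "\<dots> = (1 / real (card D)) * (1 / real n)\<^sup>2 *
      (\<Sum>t\<in>D. (norm (\<Sum>i=1..n. g (t i)))\<^sup>2)"
    by (simp add: power_mult_distrib power_divide sum_divide_distrib mult.commute)
  also have "\<dots> = 1 / real n * (1 - (real n - 1) / (real N - 1)) *
      ((\<Sum>a\<in>points N. (norm (g a))\<^sup>2) / real N)"
    unfolding D_def sum_distinct_tuples_norm_sum_square[OF assms(1,2) centred]
    using D \<open>n \<ge> 1\<close> by (auto simp: D_def power2_eq_square card_gt_0_iff)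
  also have "(\<Sum>a\<in>points N. (norm (g a))\<^sup>2) / real N = (L2_norm (unif N) f)\<^sup>2 - (norm m)\<^sup>2"
  proof -
    have "(\<Sum>a\<in>points N. (norm (g a))\<^sup>2) =
        (\<Sum>a\<in>points N. (norm (f a))\<^sup>2) - 2 * ((\<Sum>a\<in>points N. f a) \<bullet> m) + real N * (norm m)\<^sup>2"
      by (simp add: g_def power2_norm_eq_inner algebra_simps inner_commute sum.distrib
          sum_subtractf inner_sum_left inner_sum_right sum_distrib_left)
    also have "\<dots> = (\<Sum>a\<in>points N. (norm (f a))\<^sup>2) - real N * (norm m)\<^sup>2"
      by (simp add: sum_f power2_norm_eq_inner)
    finally show ?thesis
      using \<open>N \<ge> 2\<close> by (simp add: L2_norm_def integral_unif sum_nonneg diff_divide_distrib)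
  qed
  finally show ?thesis by (simp add: m_def)
qed

section \<open>The supremum over the unit sphere\<close>

lemma L2_space_unif: "f \<in> L2_space (unif N)"
  by (auto simp: L2_space_def unif_def uniform_count_measure_def integrable_point_measure_finite
      measurable_def sets_point_measure space_point_measure)

text \<open>
  The supremum is attained. The unit vector \<open>u\<close> makes the target space nontrivial; extremal
  functions can be found along the line that it spans.
\<close>
lemma SUP_Var_sampling_error:
  fixes u :: "'b::{real_inner, banach, second_countable_topology}"
  assumes "N \<ge> 2" and "n \<ge> 1" and "n \<le> N"
    and "Z \<in> M \<rightarrow>\<^sub>M count_space (tuples N n)"
    and "distr M (count_space (tuples N n)) Z =
           uniform_measure (count_space (tuples N n)) (distinct_tuples N n)"
    and "norm u = 1"
  shows "(SUP f \<in> {f :: nat \<Rightarrow> 'b. f \<in> L2_space (unif N) \<and> L2_norm (unif N) f = 1}.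
            ereal (Var M (sampling_error N n Z f)))
          = ereal (1 / real n * (1 - (real n - 1) / (real N - 1)))" (is "?S = ereal ?C")
proof (rule antisym)
  have C: "?C \<ge> 0" using assms(1-3) by simp
  show "?S \<le> ereal ?C"
  proof (rule SUP_least)
    fix f :: "nat \<Rightarrow> 'b"
    assume "f \<in> {f. f \<in> L2_space (unif N) \<and> L2_norm (unif N) f = 1}"
    then have "Var M (sampling_error N n Z f) = ?C * (1 - (norm (\<integral>x. f x \<partial>unif N))\<^sup>2)"
      using Var_sampling_error[OF assms(1-5), of f] by simp
    also have "\<dots> \<le> ?C" by (rule mult_left_le[OF _ C]) simp
    finally show "ereal (Var M (sampling_error N n Z f)) \<le> ereal ?C" by simp
  qed
  \<comment> \<open>Opposite values at two points give mean zero; their size is dictated by the norm.\<close>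
  define f where
    "f = (\<lambda>a::nat. (if a = 1 then sqrt (N / 2) else if a = 2 then - sqrt (N / 2) else 0) *\<^sub>R u)"
  have sum12: "(\<Sum>a\<in>points N. h a) = h 1 + h 2" if "\<And>a. a \<noteq> 1 \<Longrightarrow> a \<noteq> 2 \<Longrightarrow> h a = 0"
    for h :: "nat \<Rightarrow> 'c::real_vector"
  proof -
    have "(\<Sum>a\<in>points N. h a) = (\<Sum>a\<in>{1, 2}. h a)"
      using \<open>N \<ge> 2\<close> that by (intro sum.mono_neutral_right) (auto simp: points_def)
    then show ?thesis by simp
  qed
  have mean: "(\<integral>x. f x \<partial>unif N) = 0"
    unfolding integral_unif by (subst sum12) (simp_all add: f_def)
  have "(\<Sum>a\<in>points N. (norm (f a))\<^sup>2) = real N"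
    by (subst sum12) (simp_all add: f_def \<open>norm u = 1\<close>)
  then have norm: "L2_norm (unif N) f = 1"
    using \<open>N \<ge> 2\<close> by (simp add: L2_norm_def integral_unif)
  have "Var M (sampling_error N n Z f) = ?C"
    using Var_sampling_error[OF assms(1-5), of f] by (simp add: mean norm)
  then show "ereal ?C \<le> ?S"
    using norm L2_space_unif by (intro SUP_upper2[of f]) auto
qed

theorem mainTheorem3:
  fixes N n :: nat
    and M :: "'w measure"
    and Z :: "'w \<Rightarrow> nat \<Rightarrow> nat"
  assumes "N \<ge> 2" and "n \<ge> 1" and "n \<le> N"
    and "prob_space M"
    and "Z \<in> M \<rightarrow>\<^sub>M count_space (tuples N n)"
    and "distr M (count_space (tuples N n)) Z =
           uniform_measure (count_space (tuples N n)) (distinct_tuples N n)"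
  shows "(SUP f \<in> {f :: nat \<Rightarrow> real. f \<in> L2_space (unif N) \<and> L2_norm (unif N) f = 1}.
            ereal (Var M (sampling_error N n Z f)))
          = ereal (1 / real n * (1 - (real n - 1) / (real N - 1))) \<and>
         (SUP f \<in> {f :: nat \<Rightarrow> complex. f \<in> L2_space (unif N) \<and> L2_norm (unif N) f = 1}.
            ereal (Var M (sampling_error N n Z f)))
          = ereal (1 / real n * (1 - (real n - 1) / (real N - 1)))"
  using SUP_Var_sampling_error[OF assms(1-3,5,6), of "1::real"]
    SUP_Var_sampling_error[OF assms(1-3,5,6), of "1::complex"]
  by simp

end
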